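(* For a poset $M$, the following are equivalent: (i) $M$ is finitely separable; (ii) $M$ is the strong amalgam of a family $(M_p)_{p\in P}$ of nonempty finite subsets of $M$ indexed by a lower finite poset $P$; (iii) $M$ is the strong amalgam of a family $(M_p)_{p\in P}$ of nonempty finite subsets of $M$ indexed by a sublattice $P$ of $([M]^{<\omega},\cup,\cap)$, ordered by inclusion.
   Context: $[M]^{<\omega}$ denotes the set of finite subsets of $M$. A poset $P$ is lower finite if $\{q\in P: q\leq p\}$ is finite for every $p\in P$. A poset $M$ is finitely separable if there are functions $A,B$ on $M$ such that each $A(z)$ is a finite set of upper bounds of $z$, each $B(z)$ a finite set of lower bounds of $z$, and $x\leq y$ implies $A(x)\cap B(y)\neq\varnothing$. For $A\subseteq N$ in a poset $N$ and $x\in N$, $U\subseteq A$ is a lower shadow of $x$ on $A$ if $A\cap\{y:y\leq x\}=A\cap\{y: y\leq u\text{ for some }u\in U\}$, upper shadows dually; $A$ is finitely shadowing in $N$ if every element of $N$ has a finite lower shadow and a finite upper shadow on $A$. Given a poset $P$, $M$ is the strong amalgam of a family $(M_p)_{p\in P}$ of subsets of $M$ if: (1) $M=\bigcup_{p\in P}M_p$; (2) for all $p\leq q$ in $P$, $M_p\subseteq M_q$ and $M_p$ is finitely shadowing in $M_q$ (with the induced order); (3) for all $p,q\in P$, $x\in M_p$, $y\in M_q$ with $x\leq y$, there are $r\in P$ with $r\leq p$, $r\leq q$ and $z\in M_r$ with $x\leq z\leq y$. *)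

theory Defs
  imports Main
begin

text \<open>
  A poset is a carrier set \<open>M\<close> with a relation \<open>r\<close> such that \<^prop>\<open>partial_order_on M r\<close>; then
  \<open>r\<close> is contained in \<open>M \<times> M\<close> and \<^term>\<open>(x, y) \<in> r\<close> means \<open>x \<le> y\<close>. The empty poset is allowed.
\<close>

definition lower_finite :: "'i set \<Rightarrow> 'i rel \<Rightarrow> bool" where
  "lower_finite P s \<longleftrightarrow> (\<forall>p\<in>P. finite {q \<in> P. (q, p) \<in> s})"

definition finitely_separable :: "'a set \<Rightarrow> 'a rel \<Rightarrow> bool" where
  "finitely_separable M r \<longleftrightarrow>
     (\<exists>A B. (\<forall>z\<in>M. finite (A z) \<and> A z \<subseteq> {u \<in> M. (z, u) \<in> r}) \<and>
            (\<forall>z\<in>M. finite (B z) \<and> B z \<subseteq> {l \<in> M. (l, z) \<in> r}) \<and>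
            (\<forall>x\<in>M. \<forall>y\<in>M. (x, y) \<in> r \<longrightarrow> A x \<inter> B y \<noteq> {}))"

definition lower_shadow :: "'a rel \<Rightarrow> 'a set \<Rightarrow> 'a \<Rightarrow> 'a set \<Rightarrow> bool" where
  "lower_shadow r A x U \<longleftrightarrow>
     U \<subseteq> A \<and> A \<inter> {y. (y, x) \<in> r} = A \<inter> {y. \<exists>u\<in>U. (y, u) \<in> r}"

definition upper_shadow :: "'a rel \<Rightarrow> 'a set \<Rightarrow> 'a \<Rightarrow> 'a set \<Rightarrow> bool" where
  "upper_shadow r A x U \<longleftrightarrow>
     U \<subseteq> A \<and> A \<inter> {y. (x, y) \<in> r} = A \<inter> {y. \<exists>u\<in>U. (u, y) \<in> r}"

text \<open>
  For \<open>N\<close> with the order induced from \<open>r\<close>. No restriction of \<open>r\<close> is needed: all elements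
  compared below lie in \<open>A\<close> or \<open>N\<close>.
\<close>

definition finitely_shadowing :: "'a rel \<Rightarrow> 'a set \<Rightarrow> 'a set \<Rightarrow> bool" where
  "finitely_shadowing r A N \<longleftrightarrow>
     A \<subseteq> N \<and>
     (\<forall>x\<in>N. (\<exists>U. finite U \<and> lower_shadow r A x U) \<and> (\<exists>U. finite U \<and> upper_shadow r A x U))"

definition strong_amalgam ::
  "'a set \<Rightarrow> 'a rel \<Rightarrow> 'i set \<Rightarrow> 'i rel \<Rightarrow> ('i \<Rightarrow> 'a set) \<Rightarrow> bool" where
  "strong_amalgam M r P s D \<longleftrightarrow>
     M = (\<Union>p\<in>P. D p) \<and>
     (\<forall>p\<in>P. \<forall>q\<in>P. (p, q) \<in> s \<longrightarrow> D p \<subseteq> D q \<and> finitely_shadowing r (D p) (D q)) \<and>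
     (\<forall>p\<in>P. \<forall>q\<in>P. \<forall>x\<in>D p. \<forall>y\<in>D q. (x, y) \<in> r \<longrightarrow>
        (\<exists>t\<in>P. (t, p) \<in> s \<and> (t, q) \<in> s \<and> (\<exists>z\<in>D t. (x, z) \<in> r \<and> (z, y) \<in> r)))"

text \<open>
  The empty set counts as a sublattice. This matters only for the empty poset, which is finitely
  separable but is the union of no nonempty family of nonempty sets.
\<close>

definition sublattice_Fpow :: "'a set set \<Rightarrow> 'a set \<Rightarrow> bool" where
  "sublattice_Fpow P M \<longleftrightarrow>
     P \<subseteq> Fpow M \<and> (\<forall>X\<in>P. \<forall>Y\<in>P. X \<union> Y \<in> P \<and> X \<inter> Y \<in> P)"

definition lower_finite_amalgam :: "'i itself \<Rightarrow> 'a set \<Rightarrow> 'a rel \<Rightarrow> bool" where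
  "lower_finite_amalgam _ M r \<longleftrightarrow>
     (\<exists>(P :: 'i set) s D. partial_order_on P s \<and> lower_finite P s \<and>
        (\<forall>p\<in>P. D p \<noteq> {} \<and> finite (D p)) \<and> strong_amalgam M r P s D)"

definition sublattice_amalgam :: "'a set \<Rightarrow> 'a rel \<Rightarrow> bool" where
  "sublattice_amalgam M r \<longleftrightarrow>
     (\<exists>P D. sublattice_Fpow P M \<and>
        (\<forall>p\<in>P. D p \<noteq> {} \<and> finite (D p)) \<and> strong_amalgam M r P (relation_of (\<subseteq>) P) D)"

text \<open>
  A proposition cannot quantify existentially over the type of the indices in
  \<^const>\<open>lower_finite_amalgam\<close>. "Some index poset exists" is therefore expressed in two halves:
  where existence is concluded, the poset is found on the type \<^typ>\<open>'a set\<close>; where it is assumed,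
  the index type is an arbitrary \<^typ>\<open>'i\<close>.
\<close>

end

theory Submission
  imports Defs
begin

text \<open>
  A strong amalgam over a lower finite index poset is finitely separable: pick \<open>x \<in> D (p x)\<close> and
  let \<open>A x\<close>, \<open>B x\<close> be the elements above, respectively below, \<open>x\<close> in the finite set
  \<open>\<Union>q\<le>p x. D q\<close>.

  Conversely, put \<open>C x = A x \<union> B x\<close>. If every \<open>x\<close> lay in a finite \<open>C\<close>-closed set, the finite
  \<open>C\<close>-closed sets would be the required lattice, with \<open>D X = X\<close>. As \<open>C\<close>-closures may be infinite,
  well-order \<open>M\<close> and split it into blocks, the block of \<open>a\<close> consisting of the points which lie in
  the \<open>C\<close>-closure of \<open>a\<close> but of no earlier point. Each block is a countable increasing union of
  finite layers. Passing from \<open>x\<close> only to points of its block in the same or a lower layer, and to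
  points of \<open>C x\<close> in earlier blocks, generates finite closures, because the block index is
  well-founded. These closures still interpolate: when \<open>x \<le> y\<close> lie in different blocks, a point
  of \<open>A x \<inter> B y\<close> lies in a block no later than the earlier of the two, so it can replace the
  endpoint in the later block, and the block indices decrease.
\<close>

text \<open>\<open>L a n\<close> will be stage \<open>n\<close> of the closure of \<open>a\<close>.
  Then \<open>b x\<close> is the least point whose closure contains \<open>x\<close>, and
  \<open>d x\<close> is some stage of it containing \<open>x\<close>, not necessarily the
  first.\<close>

lemma layered_block_index:
  fixes L :: "'a \<Rightarrow> nat \<Rightarrow> 'a set"
  assumes "\<And>x. x \<in> L x 0"
  shows "\<exists>b d W. wf W \<and> trans W \<and> (\<forall>x y. x = y \<or> (x, y) \<in> W \<or> (y, x) \<in> W) \<and>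
    (\<forall>x. x \<in> L (b x) (d x)) \<and> (\<forall>x a n. x \<in> L a n \<longrightarrow> (a, b x) \<notin> W)"
proof -
  obtain V :: "'a rel" where V: "well_order_on UNIV V"
    using well_order_on by blast
  define W where "W = V - Id"
  have wf: "wf W"
    using V by (simp add: W_def well_order_on_def)
  have "partial_order_on UNIV V" "total_on UNIV V"
    using V by (simp_all add: well_order_on_def linear_order_on_def)
  then have trans: "trans W" and total: "\<And>x y. x = y \<or> (x, y) \<in> W \<or> (y, x) \<in> W"
    unfolding W_def
    by (auto simp: partial_order_on_def preorder_on_def total_on_def intro: trans_diff_Id)
  have "\<exists>a n. x \<in> L a n \<and> (\<forall>a' m. x \<in> L a' m \<longrightarrow> (a', a) \<notin> W)" for x
  proof -
    have "x \<in> {a. \<exists>n. x \<in> L a n}"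
      using assms by auto
    from wf[unfolded wf_eq_minimal, rule_format, OF this] show ?thesis
      by blast
  qed
  then have "\<forall>x. \<exists>a n. x \<in> L a n \<and> (\<forall>a' m. x \<in> L a' m \<longrightarrow> (a', a) \<notin> W)"
    by (rule allI)
  then obtain b d where bd: "\<forall>x. x \<in> L (b x) (d x) \<and> (\<forall>a' m. x \<in> L a' m \<longrightarrow> (a', b x) \<notin> W)"
    unfolding choice_iff by (elim exE)
  show ?thesis
    using wf trans total bd by (intro exI[of _ b] exI[of _ d] exI[of _ W] conjI) simp_all
qed

lemma finite_interpolating_closures:
  fixes r :: "'a rel" and C :: "'a \<Rightarrow> 'a set"
  assumes refl: "refl_on M r" and rM: "r \<subseteq> M \<times> M" and trans: "trans r"
    and fin: "\<And>x. finite (C x)"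
    and interp: "\<forall>x y. (x, y) \<in> r \<longrightarrow> (\<exists>z\<in>C x \<inter> C y. (x, z) \<in> r \<and> (z, y) \<in> r)"
  shows "\<exists>F. (\<forall>x. finite (F x)) \<and> (\<forall>x. x \<in> F x) \<and> (\<forall>x. \<forall>y\<in>F x. F y \<subseteq> F x) \<and>
    (\<forall>x y. (x, y) \<in> r \<longrightarrow> (\<exists>z\<in>F x \<inter> F y. (x, z) \<in> r \<and> (z, y) \<in> r))"
proof -
  \<comment> \<open>Exactly \<open>n\<close> applications of \<open>C\<close>: these sets need not
    increase with \<open>n\<close>, which is why unions over \<open>n \<le> d x\<close> appear
    below.\<close>
  define L where "L a n = ((\<lambda>X. \<Union>(C ` X)) ^^ n) {a}" for a n
  have L0: "x \<in> L x 0" for x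
    by (simp add: L_def)
  have LSuc: "z \<in> L a (Suc n)" if "x \<in> L a n" "z \<in> C x" for x z a n
    using that by (auto simp: L_def)
  have finL: "finite (L a n)" for a n
    by (induction n) (auto simp: L_def fin)
  obtain b :: "'a \<Rightarrow> 'a" and d :: "'a \<Rightarrow> nat" and W :: "'a rel"
    where W: "wf W" "trans W" "\<forall>x y. x = y \<or> (x, y) \<in> W \<or> (y, x) \<in> W"
      and bd: "\<forall>x. x \<in> L (b x) (d x)" and b_min: "\<forall>x a n. x \<in> L a n \<longrightarrow> (a, b x) \<notin> W"
    using layered_block_index[of L, OF L0] by (elim exE conjE)
  \<comment> \<open>\<open>C\<close> leads from stage \<open>d x\<close> to the next stage of the
    closure of \<open>b x\<close>, so the block of \<open>z\<close> cannot be later.\<close>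
  have bC: "b z = b x \<or> (b z, b x) \<in> W" if "z \<in> C x" for x z
    using b_min LSuc[OF bd[rule_format] that] W(3) by blast
  \<comment> \<open>Within a block \<open>z \<in> C x\<close> is not demanded, so any two points of
    one block are related by depth alone.\<close>
  define R where "R = {(z, x). b z = b x \<and> d z \<le> d x \<or> z \<in> C x \<and> (b z, b x) \<in> W}"
  define F where "F x = {z. (z, x) \<in> R\<^sup>*}" for x
  have F_self: "x \<in> F x" for x
    by (simp add: F_def)
  have F_mono: "F y \<subseteq> F x" if "y \<in> F x" for x y
    using that by (auto simp: F_def)
  have F_R: "F y \<subseteq> F x" if "(y, x) \<in> R" for x y
    using that by (auto simp: F_def)
  have "finite (F x)" for x
    using wf_inv_image[OF W(1), of b]
  proof (induction x rule: wf_induct_rule)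
    case (less x)
    define E where "E = {z. b z = b x \<and> d z \<le> d x}"
    define T where "T = {z. \<exists>y\<in>E. z \<in> C y \<and> (b z, b y) \<in> W}"
    have "E \<subseteq> (\<Union>n\<le>d x. L (b x) n)"
    proof
      fix z assume "z \<in> E"
      then have "z \<in> L (b x) (d z)" "d z \<le> d x"
        using bd[rule_format, of z] by (simp_all add: E_def)
      then show "z \<in> (\<Union>n\<le>d x. L (b x) n)" by blast
    qed
    then have finE: "finite E"
      by (rule finite_subset) (simp add: finL)
    have "T \<subseteq> (\<Union>y\<in>E. C y)"
      by (auto simp: T_def)
    then have finT: "finite T"
      by (rule finite_subset) (simp add: finE fin)
    \<comment> \<open>Going down from \<open>x\<close>, a path stays in \<open>E\<close> until it
      steps through \<open>T\<close> into an earlier block; from there on it remains in some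
      \<open>F z\<close>.\<close>
    have "w \<in> E \<union> (\<Union>z\<in>T. F z)" if "(w, x) \<in> R\<^sup>*" for w
      using that
    proof (induction rule: converse_rtrancl_induct)
      case base
      then show ?case by (simp add: E_def)
    next
      case (step v w)
      from step.IH show ?case
      proof
        assume "w \<in> E"
        then have "v \<in> E \<or> v \<in> T"
          using step.hyps(1) by (auto simp: R_def T_def E_def)
        then show ?thesis using F_self by blast
      next
        assume "w \<in> (\<Union>z\<in>T. F z)"
        then show ?thesis
          using step.hyps(1) by (auto simp: F_def intro: converse_rtrancl_into_rtrancl)
      qed
    qed
    then have "F x \<subseteq> E \<union> (\<Union>z\<in>T. F z)"
      by (auto simp: F_def)
    moreover have "finite (F z)" if "z \<in> T" for z
      using that less by (auto simp: T_def E_def)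
    ultimately show ?case
      using finE finT by (meson finite_UN_I finite_UnI finite_subset)
  qed
  moreover have "\<exists>z\<in>F x \<inter> F y. (x, z) \<in> r \<and> (z, y) \<in> r" if "(x, y) \<in> r" for x y
    \<comment> \<open>Moving one endpoint to an earlier block, with the other kept fixed, decreases
      the pair of block indices.\<close>
    using wf_inv_image[OF wf_lex_prod[OF W(1) W(1)], of "map_prod b b"] that
  proof (induction "(x, y)" arbitrary: x y rule: wf_induct_rule)
    case less
    obtain z where z: "z \<in> C x" "z \<in> C y" "(x, z) \<in> r" "(z, y) \<in> r"
      using interp less.prems by blast
    consider "b x = b y" | "(b x, b y) \<in> W" | "(b y, b x) \<in> W"
      using W(3) by blast
    then show ?case
    proof cases
      case 1
      \<comment> \<open>The endpoint of smaller depth lies in both closures and is itself the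
        interpolant.\<close>
      have "(x, x) \<in> r" "(y, y) \<in> r"
        using less.prems refl rM by (auto dest: refl_onD)
      moreover have "x \<in> F y \<or> y \<in> F x"
        using 1 linear[of "d x" "d y"] by (auto simp: F_def R_def)
      ultimately show ?thesis
        using less.prems F_self by blast
    next
      case 2
      \<comment> \<open>The block of \<open>z\<close> is no later than that of \<open>x\<close>, so
        \<open>z\<close> can replace \<open>y\<close>.\<close>
      then have bz: "(b z, b y) \<in> W"
        using bC[OF z(1)] W(2) by (auto dest: transD)
      then obtain w where w: "w \<in> F x \<inter> F z" "(x, w) \<in> r" "(w, z) \<in> r"
        using less.hyps[of x z] z by auto
      moreover have "F z \<subseteq> F y"
        using bz z by (intro F_R) (auto simp: R_def)
      ultimately show ?thesis
        using z(4) trans by (blast dest: transD)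
    next
      case 3
      then have bz: "(b z, b x) \<in> W"
        using bC[OF z(2)] W(2) by (auto dest: transD)
      then obtain w where w: "w \<in> F z \<inter> F y" "(z, w) \<in> r" "(w, y) \<in> r"
        using less.hyps[of z y] z by auto
      moreover have "F z \<subseteq> F x"
        using bz z by (intro F_R) (auto simp: R_def)
      ultimately show ?thesis
        using z(3) trans by (blast dest: transD)
    qed
  qed
  ultimately show ?thesis
    using F_self F_mono by (intro exI[of _ F] conjI allI ballI impI)
qed

text \<open>By reflexivity and transitivity, all points of \<open>A\<close> below \<open>x\<close>
  form a lower shadow, and all those above \<open>x\<close> an upper one.\<close>

lemma finite_imp_finitely_shadowing:
  assumes "refl_on M r" "trans r" "A \<subseteq> N" "N \<subseteq> M" "finite A"
  shows "finitely_shadowing r A N"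
proof -
  have refl: "(a, a) \<in> r" if "a \<in> A" for a
    using assms that by (auto dest: refl_onD)
  have "lower_shadow r A x {y\<in>A. (y, x) \<in> r}" "upper_shadow r A x {y\<in>A. (x, y) \<in> r}" for x
    unfolding lower_shadow_def upper_shadow_def
    using refl \<open>trans r\<close> by (blast dest: transD)+
  moreover have "finite {y\<in>A. (y, x) \<in> r}" "finite {y\<in>A. (x, y) \<in> r}" for x
    using \<open>finite A\<close> by simp_all
  ultimately show ?thesis
    using \<open>A \<subseteq> N\<close> unfolding finitely_shadowing_def by blast
qed

lemma finitely_separable_imp_sublattice_amalgam:
  assumes po: "partial_order_on M r" and sep: "finitely_separable M r"
  shows "sublattice_amalgam M r"
proof -
  have refl: "refl_on M r" and trans: "trans r" and rM: "r \<subseteq> M \<times> M"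
    using po by (auto simp: partial_order_on_def preorder_on_def)
  obtain A B where A: "\<forall>z\<in>M. finite (A z) \<and> A z \<subseteq> {u \<in> M. (z, u) \<in> r}"
    and B: "\<forall>z\<in>M. finite (B z) \<and> B z \<subseteq> {l \<in> M. (l, z) \<in> r}"
    and AB: "\<forall>x\<in>M. \<forall>y\<in>M. (x, y) \<in> r \<longrightarrow> A x \<inter> B y \<noteq> {}"
    using sep unfolding finitely_separable_def by (elim exE conjE)
  \<comment> \<open>The value \<open>{}\<close> outside \<open>M\<close> keeps \<open>C\<close>
    finite on the whole type, where \<open>F\<close> is defined.\<close>
  define C where "C x = (if x \<in> M then A x \<union> B x else {})" for x
  have finC: "finite (C x)" for x
    using A B by (simp add: C_def)
  have interpC: "\<forall>x y. (x, y) \<in> r \<longrightarrow> (\<exists>z\<in>C x \<inter> C y. (x, z) \<in> r \<and> (z, y) \<in> r)"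
  proof (intro allI impI)
    fix x y assume xy: "(x, y) \<in> r"
    have M: "x \<in> M" "y \<in> M" using xy rM by auto
    then obtain z where "z \<in> A x" "z \<in> B y" using AB xy by blast
    moreover have "(x, z) \<in> r" "(z, y) \<in> r"
      using A B M calculation by blast+
    ultimately show "\<exists>z\<in>C x \<inter> C y. (x, z) \<in> r \<and> (z, y) \<in> r"
      using M by (auto simp: C_def)
  qed
  obtain F where F: "\<forall>x. finite (F x)" "\<forall>x. x \<in> F x" "\<forall>x. \<forall>y\<in>F x. F y \<subseteq> F x"
    and interp: "\<forall>x y. (x, y) \<in> r \<longrightarrow> (\<exists>z\<in>F x \<inter> F y. (x, z) \<in> r \<and> (z, y) \<in> r)"
    using finite_interpolating_closures[OF refl rM trans finC interpC] by (elim exE conjE)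
  \<comment> \<open>A common point \<open>m\<close> keeps all intersections nonempty; if \<open>M\<close> is empty then so is \<open>P\<close>.\<close>
  define m where "m = (SOME m. m \<in> M)"
  have m: "m \<in> M" if "x \<in> M" for x
    using that unfolding m_def by (rule someI)
  \<comment> \<open>Closedness is tested point by point, hence survives unions and intersections. As
    \<open>F x\<close> is not known to stay in \<open>M\<close>, it is cut down to
    \<open>M\<close>.\<close>
  define P where "P = {X \<in> Fpow M. m \<in> X \<and> (\<forall>x\<in>X. F x \<inter> M \<subseteq> X)}"
  have P_Int: "X \<inter> Y \<in> P" if "X \<in> P" "Y \<in> P" for X Y
    using that by (auto simp: P_def Fpow_def)
  have P_Un: "X \<union> Y \<in> P" if "X \<in> P" "Y \<in> P" for X Y
    using that by (auto simp: P_def Fpow_def)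
  have PM: "X \<subseteq> M \<and> finite X \<and> X \<noteq> {}" if "X \<in> P" for X
    using that by (auto simp: P_def Fpow_def)
  have "(F x \<union> F m) \<inter> M \<in> P" if "x \<in> M" for x
    using F m[OF that] by (simp add: P_def Fpow_def) blast
  then have union: "M = (\<Union>X\<in>P. X)"
    using F(2) PM by blast
  have strong: "strong_amalgam M r P (relation_of (\<subseteq>) P) (\<lambda>X. X)"
    unfolding strong_amalgam_def
  proof (intro conjI ballI impI)
    show "M = (\<Union>X\<in>P. X)" by (rule union)
  next
    fix X Y assume "X \<in> P" "Y \<in> P" "(X, Y) \<in> relation_of (\<subseteq>) P"
    then show "X \<subseteq> Y" "finitely_shadowing r X Y"
      using PM finite_imp_finitely_shadowing[OF refl trans] by (auto simp: relation_of_def)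
  next
    fix X Y x y assume X: "X \<in> P" and Y: "Y \<in> P" and "x \<in> X" "y \<in> Y" "(x, y) \<in> r"
    moreover from interp[rule_format, OF \<open>(x, y) \<in> r\<close>]
    obtain z where z: "z \<in> F x" "z \<in> F y" "(x, z) \<in> r" "(z, y) \<in> r" by blast
    moreover have "z \<in> M" using z rM by auto
    ultimately have "z \<in> X \<inter> Y" by (auto simp: P_def)
    then show "\<exists>t\<in>P. (t, X) \<in> relation_of (\<subseteq>) P \<and> (t, Y) \<in> relation_of (\<subseteq>) P \<and>
        (\<exists>z\<in>t. (x, z) \<in> r \<and> (z, y) \<in> r)"
      using P_Int[OF X Y] X Y z by (intro bexI[of _ "X \<inter> Y"]) (auto simp: relation_of_def)
  qed
  have "sublattice_Fpow P M"
    using P_Int P_Un by (auto simp: sublattice_Fpow_def P_def)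
  with strong PM show ?thesis
    unfolding sublattice_amalgam_def by (intro exI[of _ P] exI[of _ "\<lambda>X. X"]) auto
qed

lemma sublattice_amalgam_imp_lower_finite_amalgam:
  fixes M :: "'a set"
  assumes "sublattice_amalgam M r"
  shows "lower_finite_amalgam TYPE('a set) M r"
proof -
  obtain P D where P: "sublattice_Fpow P M" and D: "\<forall>p\<in>P. D p \<noteq> {} \<and> finite (D p)"
    "strong_amalgam M r P (relation_of (\<subseteq>) P) D"
    using assms unfolding sublattice_amalgam_def by blast
  have "partial_order_on P (relation_of (\<subseteq>) P)"
    by (auto simp: partial_order_on_def preorder_on_def refl_on_def trans_def antisym_def
        relation_of_def)
  moreover have "lower_finite P (relation_of (\<subseteq>) P)"
    unfolding lower_finite_def
  proof
    fix p assume "p \<in> P"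
    then have "finite (Pow p)"
      using P by (auto simp: sublattice_Fpow_def Fpow_def)
    then show "finite {q \<in> P. (q, p) \<in> relation_of (\<subseteq>) P}"
      by (rule rev_finite_subset) (auto simp: relation_of_def)
  qed
  ultimately show ?thesis
    using D unfolding lower_finite_amalgam_def by blast
qed

lemma lower_finite_amalgam_imp_finitely_separable:
  fixes M :: "'a set"
  assumes "lower_finite_amalgam TYPE('i) M r"
  shows "finitely_separable M r"
proof -
  obtain P :: "'i set" and s D where lf: "lower_finite P s"
    and fin: "\<And>p. p \<in> P \<Longrightarrow> finite (D p)" and am: "strong_amalgam M r P s D"
    using assms unfolding lower_finite_amalgam_def by blast
  have M: "M = (\<Union>p\<in>P. D p)"
    using am by (simp add: strong_amalgam_def)
  then obtain c where c: "\<And>x. x \<in> M \<Longrightarrow> c x \<in> P \<and> x \<in> D (c x)"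
    by (metis UN_E)
  define E where "E x = (\<Union>q\<in>{q \<in> P. (q, c x) \<in> s}. D q)" for x
  have finE: "finite (E x)" if "x \<in> M" for x
    using lf c[OF that] fin by (auto simp: E_def lower_finite_def)
  have EM: "E x \<subseteq> M" for x
    unfolding E_def M by blast
  \<comment> \<open>The amalgam index \<open>t\<close> lies below both \<open>c x\<close> and
    \<open>c y\<close>, so \<open>D t\<close> is contained in both \<open>E x\<close> and
    \<open>E y\<close>.\<close>
  have interp: "\<exists>z\<in>E x \<inter> E y. (x, z) \<in> r \<and> (z, y) \<in> r"
    if x: "x \<in> M" and y: "y \<in> M" and xy: "(x, y) \<in> r" for x y
  proof -
    obtain t z where "t \<in> P" "(t, c x) \<in> s" "(t, c y) \<in> s" "z \<in> D t" "(x, z) \<in> r" "(z, y) \<in> r"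
      using am c[OF x] c[OF y] xy unfolding strong_amalgam_def by meson
    then show ?thesis by (auto simp: E_def)
  qed
  show ?thesis
    unfolding finitely_separable_def
  proof (intro exI conjI)
    show "\<forall>z\<in>M. finite {u \<in> E z. (z, u) \<in> r} \<and> {u \<in> E z. (z, u) \<in> r} \<subseteq> {u \<in> M. (z, u) \<in> r}"
      "\<forall>z\<in>M. finite {l \<in> E z. (l, z) \<in> r} \<and> {l \<in> E z. (l, z) \<in> r} \<subseteq> {l \<in> M. (l, z) \<in> r}"
      using finE EM by auto
    show "\<forall>x\<in>M. \<forall>y\<in>M. (x, y) \<in> r \<longrightarrow> {u \<in> E x. (x, u) \<in> r} \<inter> {l \<in> E y. (l, y) \<in> r} \<noteq> {}"
      using interp by blast
  qed
qed

theorem theorem3p6: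
  fixes M :: "'a set" and r :: "'a rel"
  assumes "partial_order_on M r"
  shows "(finitely_separable M r \<longleftrightarrow> lower_finite_amalgam TYPE('a set) M r) \<and>
         (finitely_separable M r \<longleftrightarrow> sublattice_amalgam M r) \<and>
         (lower_finite_amalgam TYPE('i) M r \<longrightarrow> finitely_separable M r)"
  using finitely_separable_imp_sublattice_amalgam[OF assms]
    sublattice_amalgam_imp_lower_finite_amalgam[of M r]
    lower_finite_amalgam_imp_finitely_separable[where 'i = "'a set", of M r]
    lower_finite_amalgam_imp_finitely_separable[where 'i = 'i, of M r]
  by blast

end
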